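(* Let $S$ be an inverse semigroup, regarded as a restriction semigroup $(S,E(S),\lambda,\rho)$ with $E(S)$ its set of idempotents, $\lambda(s)=s^*s$ and $\rho(s)=ss^*$. Then $\mathcal A(S)=C^*(S)$ and $\mathcal A_r(S)=C^*_{red}(S)$; that is, the seminorms on $\mathbb C[S]$ defining $\mathcal A(S)$ and $C^*(S)$ coincide, and the norms on $\mathbb C[S]$ defining $\mathcal A_r(S)$ and $C^*_{red}(S)$ coincide.
   Context: A representation of a restriction semigroup $(S,E,\lambda,\rho)$ on a Hilbert space $H$ is a semigroup homomorphism $\sigma:S\to B(H)$ with $\|\sigma_s\|\le1$ for all $s\in S$ and $\sigma_e^*=\sigma_e^2=\sigma_e$ for all $e\in E$ (no compatibility with any involution of $S$ is required). It extends linearly to $\widetilde\sigma:\mathbb C[S]\to B(H)$, where $\mathbb C[S]$ is the complex semigroup algebra with basis $\{\delta_s\}_{s\in S}$. The operator algebra $\mathcal A(S)$ is the Hausdorff completion (quotient by the null space, then completion) of $\mathbb C[S]$ in the seminorm $\|x\|_0=\sup_\sigma\|\widetilde\sigma(x)\|$ over all representations. If $S$ is left-ample (i.e. $st=su$ implies $\lambda(s)t=\lambda(s)u$; inverse semigroups are left-ample), the regular representation $\phi':S\to B(\ell_2(S))$ is given by $\phi'_s(\delta_t)=\delta_{st}$ if $\rho(t)\le\lambda(s)$ and $\phi'_s(\delta_t)=0$ otherwise, where for $e,f\in E$, $e\le f$ means $ef=e$. The reduced operator algebra $\mathcal A_r(S)$ is the norm closure of $\widetilde{\phi'}(\mathbb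 C[S])$ in $B(\ell_2(S))$. For an inverse semigroup $S$, $C^*(S)$ is the completion of $\mathbb C[S]$ with respect to $\sup\|\widetilde\sigma(x)\|$ over all $*$-representations $\sigma$ of $S$, i.e. semigroup homomorphisms $\sigma:S\to B(H)$ with $\sigma_{s^*}=\sigma_s^*$. $C^*_{red}(S)$ is the norm closure of the image of $\mathbb C[S]$ under the left regular (Wagner–Preston) representation of $S$ on $\ell_2(S)$, in which $s$ acts by $\delta_t\mapsto\delta_{st}$ if $tt^*\le s^*s$ and $\delta_t\mapsto0$ otherwise (a partial isometry with initial space spanned by $\{\delta_t:tt^*\le s^*s\}$ and final space spanned by $\{\delta_t:tt^*\le ss^*\}$). *)

theory Defs
  imports "HOL-Analysis.Analysis" "HOL-Algebra.Module" "HOL-Library.Poly_Mapping"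
begin

section \<open>Complex Hilbert spaces and bounded operators\<close>

text \<open>Hilbert spaces are modelled with explicit carriers, because suprema over all Hilbert spaces
  are formed below and HOL cannot quantify over types inside a formula. The components \<open>mult\<close> and
  \<open>one\<close> inherited from the record of modules are irrelevant.\<close>

record 'h hilbert = "(complex, 'h) module" +
  cinner :: "'h \<Rightarrow> 'h \<Rightarrow> complex"

definition complex_ring :: "complex ring" where
  "complex_ring = \<lparr>carrier = UNIV, mult = (*), one = 1, zero = 0, add = (+)\<rparr>"

definition hnorm :: "'h hilbert \<Rightarrow> 'h \<Rightarrow> real" where
  "hnorm H v = sqrt (Re (cinner H v v))"

text \<open>Distances are set to 0 outside the relevant set, since the locale of metric spaces requires
  a distance that is nonnegative and symmetric on the whole type.\<close>

definition hdist :: "'h hilbert \<Rightarrow> 'h \<Rightarrow> 'h \<Rightarrow> real" where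
  "hdist H v w =
     (if v \<in> carrier H \<and> w \<in> carrier H then hnorm H (v \<ominus>\<^bsub>H\<^esub> w) else 0)"

definition hilbert_space :: "'h hilbert \<Rightarrow> bool" where
  "hilbert_space H \<longleftrightarrow>
     Module.module complex_ring H \<and>
     (\<forall>u\<in>carrier H. \<forall>v\<in>carrier H. \<forall>w\<in>carrier H.
        cinner H (u \<oplus>\<^bsub>H\<^esub> v) w = cinner H u w + cinner H v w) \<and>
     (\<forall>a. \<forall>v\<in>carrier H. \<forall>w\<in>carrier H. cinner H (a \<odot>\<^bsub>H\<^esub> v) w = a * cinner H v w) \<and>
     (\<forall>v\<in>carrier H. \<forall>w\<in>carrier H. cinner H w v = cnj (cinner H v w)) \<and>
     (\<forall>v\<in>carrier H. 0 \<le> Re (cinner H v v)) \<and>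
     (\<forall>v\<in>carrier H. cinner H v v = 0 \<longrightarrow> v = \<zero>\<^bsub>H\<^esub>) \<and>
     Metric_space.mcomplete (carrier H) (hdist H)"

text \<open>\<open>bop H\<close> is \<open>B(H)\<close>; operators are extensional functions, so that equality of operators is
  equality in HOL and composition is \<open>compose (carrier H)\<close>.\<close>

definition bop :: "'h hilbert \<Rightarrow> ('h \<Rightarrow> 'h) set" where
  "bop H = {T \<in> carrier H \<rightarrow>\<^sub>E carrier H.
     (\<forall>v\<in>carrier H. \<forall>w\<in>carrier H. T (v \<oplus>\<^bsub>H\<^esub> w) = T v \<oplus>\<^bsub>H\<^esub> T w) \<and>
     (\<forall>a. \<forall>v\<in>carrier H. T (a \<odot>\<^bsub>H\<^esub> v) = a \<odot>\<^bsub>H\<^esub> T v) \<and>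
     (\<exists>c. \<forall>v\<in>carrier H. hnorm H (T v) \<le> c * hnorm H v)}"

definition opnorm :: "'h hilbert \<Rightarrow> ('h \<Rightarrow> 'h) \<Rightarrow> real" where
  "opnorm H T = Sup {hnorm H (T v) | v. v \<in> carrier H \<and> hnorm H v \<le> 1}"

definition opdist :: "'h hilbert \<Rightarrow> ('h \<Rightarrow> 'h) \<Rightarrow> ('h \<Rightarrow> 'h) \<Rightarrow> real" where
  "opdist H T U = (if T \<in> bop H \<and> U \<in> bop H
     then opnorm H (\<lambda>v\<in>carrier H. T v \<ominus>\<^bsub>H\<^esub> U v) else 0)"

text \<open>For \<open>T, U \<in> bop H\<close>, \<open>is_adjoint H T U\<close> says \<open>U = T\<^sup>*\<close>.\<close>

definition is_adjoint :: "'h hilbert \<Rightarrow> ('h \<Rightarrow> 'h) \<Rightarrow> ('h \<Rightarrow> 'h) \<Rightarrow> bool" where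
  "is_adjoint H T U \<longleftrightarrow>
     (\<forall>v\<in>carrier H. \<forall>w\<in>carrier H. cinner H (T v) w = cinner H v (U w))"

definition ell2 :: "('s \<Rightarrow> complex) hilbert" where
  "ell2 = \<lparr>carrier = {f. (\<lambda>t. (cmod (f t))\<^sup>2) summable_on UNIV},
     mult = undefined, one = undefined,
     zero = (\<lambda>_. 0), add = (\<lambda>f g t. f t + g t), smult = (\<lambda>a f t. a * f t),
     cinner = (\<lambda>f g. \<Sum>\<^sub>\<infinity>t. f t * cnj (g t))\<rparr>"

section \<open>The semigroup algebra and its completions\<close>

text \<open>\<open>\<complex>[S]\<close> is the space \<open>'s \<Rightarrow>\<^sub>0 complex\<close> of finitely supported functions; \<open>\<delta>\<^sub>s\<close> is
  \<open>Poly_Mapping.single s 1\<close>. The library product on this type is for additively written monoids, so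
  the convolution product is defined separately.\<close>

definition sa_mult :: "('s::semigroup_mult \<Rightarrow>\<^sub>0 complex) \<Rightarrow> ('s \<Rightarrow>\<^sub>0 complex) \<Rightarrow> ('s \<Rightarrow>\<^sub>0 complex)" where
  "sa_mult x y = (\<Sum>s\<in>Poly_Mapping.keys x. \<Sum>t\<in>Poly_Mapping.keys y.
     Poly_Mapping.single (s * t) (Poly_Mapping.lookup x s * Poly_Mapping.lookup y t))"

definition sa_scale :: "complex \<Rightarrow> ('s \<Rightarrow>\<^sub>0 complex) \<Rightarrow> ('s \<Rightarrow>\<^sub>0 complex)" where
  "sa_scale a x = Poly_Mapping.map (\<lambda>c. a * c) x"

definition lin_ext :: "'h hilbert \<Rightarrow> ('s \<Rightarrow> 'h \<Rightarrow> 'h) \<Rightarrow> ('s \<Rightarrow>\<^sub>0 complex) \<Rightarrow> 'h \<Rightarrow> 'h" where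
  "lin_ext H \<sigma> x = (\<lambda>v\<in>carrier H.
     \<Oplus>\<^bsub>H\<^esub>s\<in>Poly_Mapping.keys x. Poly_Mapping.lookup x s \<odot>\<^bsub>H\<^esub> \<sigma> s v)"

text \<open>The Hausdorff completion of \<open>\<complex>[S]\<close> in a seminorm \<open>p\<close>: Cauchy sequences modulo null
  sequences, which performs the quotient by the null space of \<open>p\<close> and the completion at once.
  The completion need not have a unit, so \<open>one\<close> is left unspecified.\<close>

record 'b normed_alg = "(complex, 'b) module" +
  alg_norm :: "'b \<Rightarrow> real"

definition cauchy_seqs :: "(('s \<Rightarrow>\<^sub>0 complex) \<Rightarrow> real) \<Rightarrow> (nat \<Rightarrow> ('s \<Rightarrow>\<^sub>0 complex)) set" where
  "cauchy_seqs p = {X. \<forall>e>0. \<exists>N. \<forall>m\<ge>N. \<forall>n\<ge>N. p (X m - X n) < e}"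

definition null_rel ::
    "(('s \<Rightarrow>\<^sub>0 complex) \<Rightarrow> real) \<Rightarrow> ((nat \<Rightarrow> ('s \<Rightarrow>\<^sub>0 complex)) \<times> (nat \<Rightarrow> ('s \<Rightarrow>\<^sub>0 complex))) set" where
  "null_rel p = {(X, Y). X \<in> cauchy_seqs p \<and> Y \<in> cauchy_seqs p \<and>
     (\<lambda>n. p (X n - Y n)) \<longlonglongrightarrow> 0}"

definition completion ::
    "(('s::semigroup_mult \<Rightarrow>\<^sub>0 complex) \<Rightarrow> real) \<Rightarrow> (nat \<Rightarrow> ('s \<Rightarrow>\<^sub>0 complex)) set normed_alg" where
  "completion p = \<lparr>carrier = cauchy_seqs p // null_rel p,
     mult = (\<lambda>A B. null_rel p `` {(\<lambda>n. sa_mult (X n) (Y n)) | X Y. X \<in> A \<and> Y \<in> B}),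
     one = undefined,
     zero = null_rel p `` {\<lambda>_. 0},
     add = (\<lambda>A B. null_rel p `` {(\<lambda>n. X n + Y n) | X Y. X \<in> A \<and> Y \<in> B}),
     smult = (\<lambda>a A. null_rel p `` {(\<lambda>n. sa_scale a (X n)) | X. X \<in> A}),
     alg_norm = (\<lambda>A. THE r. \<forall>X\<in>A. (\<lambda>n. p (X n)) \<longlonglongrightarrow> r)\<rparr>"

definition image_closure :: "'h hilbert \<Rightarrow> ('s \<Rightarrow> 'h \<Rightarrow> 'h) \<Rightarrow> ('h \<Rightarrow> 'h) set" where
  "image_closure H \<sigma> =
     Metric_space.mtopology (bop H) (opdist H) closure_of range (lin_ext H \<sigma>)"

text \<open>The bounded operator on \<open>\<ell>\<^sub>2\<close> given by \<open>\<delta>\<^sub>t \<mapsto> \<delta>\<^bsub>g t\<^esub>\<close> for \<open>t \<in> D\<close> and \<open>\<delta>\<^sub>t \<mapsto> 0\<close> otherwise,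
  for \<open>g\<close> injective on \<open>D\<close> (then each sum has at most one term).\<close>

definition basis_op :: "'s set \<Rightarrow> ('s \<Rightarrow> 's) \<Rightarrow> ('s \<Rightarrow> complex) \<Rightarrow> ('s \<Rightarrow> complex)" where
  "basis_op D g = (\<lambda>f\<in>carrier ell2. \<lambda>u. \<Sum>\<^sub>\<infinity>t\<in>{t\<in>D. g t = u}. f t)"

definition basis_vec :: "'s \<Rightarrow> 's \<Rightarrow> complex" where
  "basis_vec t = (\<lambda>u. if u = t then 1 else 0)"

lemma basis_vec_ell2: "basis_vec t \<in> carrier ell2"
proof -
  have "(\<lambda>u. (cmod (basis_vec t u))\<^sup>2) summable_on {t}" by simp
  then have "(\<lambda>u. (cmod (basis_vec t u))\<^sup>2) summable_on UNIV"
    by (rule summable_on_cong_neutral[THEN iffD1, rotated -1]) (auto simp: basis_vec_def)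
  then show ?thesis by (simp add: ell2_def)
qed

lemma basis_op_basis_vec:
  "basis_op D g (basis_vec t) = (if t \<in> D then basis_vec (g t) else (\<lambda>_. 0))"
proof
  fix u
  have "(\<Sum>\<^sub>\<infinity>t'\<in>{t'\<in>D. g t' = u}. basis_vec t t')
      = (\<Sum>\<^sub>\<infinity>t'\<in>{t} \<inter> {t'\<in>D. g t' = u}. basis_vec t t')"
    by (rule infsum_cong_neutral) (auto simp: basis_vec_def)
  also have "\<dots> = (if t \<in> D \<and> g t = u then 1 else 0)"
    by (cases "t \<in> D \<and> g t = u") (auto simp: basis_vec_def Int_insert_left)
  finally show "basis_op D g (basis_vec t) u
      = (if t \<in> D then basis_vec (g t) else (\<lambda>_. 0)) u"
    by (simp add: basis_op_def basis_vec_ell2) (auto simp: basis_vec_def)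
qed

section \<open>Operator algebras of a restriction semigroup\<close>

text \<open>The constructions for \<open>(S, E, \<lambda>, \<rho>)\<close>, where \<open>S\<close> is the whole type \<open>'s\<close>. They use only the
  data \<open>E\<close>, \<open>\<lambda>\<close>, \<open>\<rho>\<close>, which are explicit parameters as needed.\<close>

definition representation :: "'s::semigroup_mult set \<Rightarrow> 'h hilbert \<Rightarrow> ('s \<Rightarrow> 'h \<Rightarrow> 'h) \<Rightarrow> bool" where
  "representation E H \<sigma> \<longleftrightarrow>
     (\<forall>s. \<sigma> s \<in> bop H) \<and>
     (\<forall>s t. \<sigma> (s * t) = compose (carrier H) (\<sigma> s) (\<sigma> t)) \<and>
     (\<forall>s. opnorm H (\<sigma> s) \<le> 1) \<and>
     (\<forall>e\<in>E. is_adjoint H (\<sigma> e) (\<sigma> e) \<and> compose (carrier H) (\<sigma> e) (\<sigma> e) = \<sigma> e)"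

text \<open>The type argument bounds the size of the Hilbert spaces considered: all Hilbert spaces whose
  underlying set is a subset of \<open>'h\<close>. Passing to cyclic subrepresentations shows that the supremum
  no longer changes once \<open>'h\<close> has at least the cardinality of \<open>'s \<times> nat \<Rightarrow> complex\<close>.\<close>

definition op_seminorm :: "'h itself \<Rightarrow> 's::semigroup_mult set \<Rightarrow> ('s \<Rightarrow>\<^sub>0 complex) \<Rightarrow> real" where
  "op_seminorm _ E x = Sup {opnorm H (lin_ext H \<sigma> x) | (H :: 'h hilbert) \<sigma>.
     hilbert_space H \<and> representation E H \<sigma>}"

definition op_algebra ::
    "'h itself \<Rightarrow> 's::semigroup_mult set \<Rightarrow> (nat \<Rightarrow> ('s \<Rightarrow>\<^sub>0 complex)) set normed_alg" where
  "op_algebra h E = completion (op_seminorm h E)"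

definition idem_le :: "'s::semigroup_mult \<Rightarrow> 's \<Rightarrow> bool" where
  "idem_le e f \<longleftrightarrow> e * f = e"

definition left_ample :: "('s::semigroup_mult \<Rightarrow> 's) \<Rightarrow> bool" where
  "left_ample lam \<longleftrightarrow> (\<forall>s t u. s * t = s * u \<longrightarrow> lam s * t = lam s * u)"

definition regular_rep ::
    "('s::semigroup_mult \<Rightarrow> 's) \<Rightarrow> ('s \<Rightarrow> 's) \<Rightarrow> 's \<Rightarrow> ('s \<Rightarrow> complex) \<Rightarrow> ('s \<Rightarrow> complex)" where
  "regular_rep lam rho s = basis_op {t. idem_le (rho t) (lam s)} (\<lambda>t. s * t)"

definition reduced_norm ::
    "('s::semigroup_mult \<Rightarrow> 's) \<Rightarrow> ('s \<Rightarrow> 's) \<Rightarrow> ('s \<Rightarrow>\<^sub>0 complex) \<Rightarrow> real" where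
  "reduced_norm lam rho x = opnorm ell2 (lin_ext ell2 (regular_rep lam rho) x)"

definition reduced_op_algebra ::
    "('s::semigroup_mult \<Rightarrow> 's) \<Rightarrow> ('s \<Rightarrow> 's) \<Rightarrow> (('s \<Rightarrow> complex) \<Rightarrow> ('s \<Rightarrow> complex)) set" where
  "reduced_op_algebra lam rho = image_closure ell2 (regular_rep lam rho)"

section \<open>Inverse semigroups and their C*-algebras\<close>

class inverse_semigroup = semigroup_mult +
  assumes ex1_sinv: "\<exists>!t. s * t * s = s \<and> t * s * t = t"

definition sinv :: "'s::inverse_semigroup \<Rightarrow> 's" where
  "sinv s = (THE t. s * t * s = s \<and> t * s * t = t)"

lemma sinv_props:
  fixes s :: "'s::inverse_semigroup"
  shows "s * sinv s * s = s" and "sinv s * s * sinv s = sinv s"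
  using theI'[OF ex1_sinv[of s]] unfolding sinv_def by blast+

definition idempotents :: "'s::semigroup_mult set" where
  "idempotents = {e. e * e = e}"

definition inv_lam :: "'s::inverse_semigroup \<Rightarrow> 's" where
  "inv_lam s = sinv s * s"

definition inv_rho :: "'s::inverse_semigroup \<Rightarrow> 's" where
  "inv_rho s = s * sinv s"

lemma left_ample_inv_lam: "left_ample (inv_lam :: 's::inverse_semigroup \<Rightarrow> 's)"
  unfolding left_ample_def inv_lam_def by (simp add: mult.assoc)

definition star_representation :: "'h hilbert \<Rightarrow> ('s::inverse_semigroup \<Rightarrow> 'h \<Rightarrow> 'h) \<Rightarrow> bool" where
  "star_representation H \<sigma> \<longleftrightarrow>
     (\<forall>s. \<sigma> s \<in> bop H) \<and>
     (\<forall>s t. \<sigma> (s * t) = compose (carrier H) (\<sigma> s) (\<sigma> t)) \<and>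
     (\<forall>s. is_adjoint H (\<sigma> s) (\<sigma> (sinv s)))"

definition cstar_seminorm :: "'h itself \<Rightarrow> ('s::inverse_semigroup \<Rightarrow>\<^sub>0 complex) \<Rightarrow> real" where
  "cstar_seminorm _ x = Sup {opnorm H (lin_ext H \<sigma> x) | (H :: 'h hilbert) \<sigma>.
     hilbert_space H \<and> star_representation H \<sigma>}"

definition cstar_algebra ::
    "'h itself \<Rightarrow> (nat \<Rightarrow> ('s::inverse_semigroup \<Rightarrow>\<^sub>0 complex)) set normed_alg" where
  "cstar_algebra h = completion (cstar_seminorm h)"

definition wagner_preston :: "'s::inverse_semigroup \<Rightarrow> ('s \<Rightarrow> complex) \<Rightarrow> ('s \<Rightarrow> complex)" where
  "wagner_preston s = basis_op {t. idem_le (t * sinv t) (sinv s * s)} (\<lambda>t. s * t)"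

definition cstar_reduced_norm :: "('s::inverse_semigroup \<Rightarrow>\<^sub>0 complex) \<Rightarrow> real" where
  "cstar_reduced_norm x = opnorm ell2 (lin_ext ell2 wagner_preston x)"

definition cstar_reduced :: "(('s::inverse_semigroup \<Rightarrow> complex) \<Rightarrow> ('s \<Rightarrow> complex)) set" where
  "cstar_reduced = image_closure ell2 wagner_preston"

end

theory Submission
  imports Defs
begin

text \<open>The seminorms coincide because, on each Hilbert space, the two suprema range over the same
  maps \<open>\<sigma>\<close> (lemma \<open>representation_iff_star_representation\<close>). A \<open>*\<close>-representation sends idempotents
  to projections, and \<open>\<sigma>\<^sub>s\<^sup>* \<sigma>\<^sub>s\<close> is the projection \<open>\<sigma>\<^bsub>s\<^sup>*s\<^esub>\<close>, so that \<open>\<sigma>\<^sub>s\<close> is a contraction.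
  For the converse, put \<open>T = \<sigma>\<^sub>s\<close> and \<open>U = \<sigma>\<^bsub>s\<^sup>*\<^esub>\<close>. Both are contractions, \<open>T U T = T\<close>, \<open>U T U = U\<close>, and
  \<open>T U\<close> and \<open>U T\<close> are projections. Then
  \<open>\<parallel>U T v\<parallel> \<le> \<parallel>T v\<parallel> = \<parallel>T (U T v)\<parallel> \<le> \<parallel>U T v\<parallel>\<close>,
  so \<open>T\<close> is a partial isometry with initial projection \<open>U T\<close>, and a partial isometry has only one
  generalised inverse \<open>U\<close> making both \<open>T U\<close> and \<open>U T\<close> projections, its adjoint: hence \<open>U = T\<^sup>*\<close>
  (lemma \<open>contractive_inverse_is_adjoint\<close>).

  The reduced norms and algebras coincide because, for \<open>\<lambda>(s) = s\<^sup>*s\<close> and \<open>\<rho>(s) = ss\<^sup>*\<close>, the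
  regular representation is by definition the Wagner--Preston representation.\<close>

section \<open>Inner products and contractions\<close>

lemma hilbert_space_closed:
  assumes "hilbert_space H"
  shows "\<zero>\<^bsub>H\<^esub> \<in> carrier H"
    and "v \<in> carrier H \<Longrightarrow> w \<in> carrier H \<Longrightarrow> v \<oplus>\<^bsub>H\<^esub> w \<in> carrier H"
    and "v \<in> carrier H \<Longrightarrow> a \<odot>\<^bsub>H\<^esub> v \<in> carrier H"
proof -
  interpret Module.module complex_ring H using assms unfolding hilbert_space_def by (rule conjunct1)
  show "\<zero>\<^bsub>H\<^esub> \<in> carrier H" by simp
  show "v \<in> carrier H \<Longrightarrow> w \<in> carrier H \<Longrightarrow> v \<oplus>\<^bsub>H\<^esub> w \<in> carrier H" by simp
  show "v \<in> carrier H \<Longrightarrow> a \<odot>\<^bsub>H\<^esub> v \<in> carrier H"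
    by (rule smult_closed) (simp_all add: complex_ring_def)
qed

lemma cinner_sesquilinear:
  assumes "hilbert_space H" "u \<in> carrier H" "v \<in> carrier H" "w \<in> carrier H"
  shows "cinner H w v = cnj (cinner H v w)"
    and "cinner H (u \<oplus>\<^bsub>H\<^esub> v) w = cinner H u w + cinner H v w"
    and "cinner H w (u \<oplus>\<^bsub>H\<^esub> v) = cinner H w u + cinner H w v"
    and "cinner H (a \<odot>\<^bsub>H\<^esub> v) w = a * cinner H v w"
    and "cinner H w (a \<odot>\<^bsub>H\<^esub> v) = cnj a * cinner H w v"
proof -
  have herm: "cinner H y x = cnj (cinner H x y)" if "x \<in> carrier H" "y \<in> carrier H" for x y
    using assms(1) that unfolding hilbert_space_def by blast
  show add: "cinner H (u \<oplus>\<^bsub>H\<^esub> v) w = cinner H u w + cinner H v w"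
    and scale: "cinner H (a \<odot>\<^bsub>H\<^esub> v) w = a * cinner H v w"
    using assms unfolding hilbert_space_def by blast+
  show "cinner H w v = cnj (cinner H v w)" using herm assms by blast
  have "cinner H w (u \<oplus>\<^bsub>H\<^esub> v) = cnj (cinner H u w + cinner H v w)"
    using herm[of "u \<oplus>\<^bsub>H\<^esub> v" w] add hilbert_space_closed(2)[OF assms(1-3)] assms(4) by simp
  also have "\<dots> = cinner H w u + cinner H w v"
    unfolding complex_cnj_add using herm[of u w] herm[of v w] assms by metis
  finally show "cinner H w (u \<oplus>\<^bsub>H\<^esub> v) = cinner H w u + cinner H w v" .
  have "cinner H w (a \<odot>\<^bsub>H\<^esub> v) = cnj (a * cinner H v w)"
    using herm[of "a \<odot>\<^bsub>H\<^esub> v" w] scale hilbert_space_closed(3)[OF assms(1,3)] assms(4) by simp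
  also have "\<dots> = cnj a * cinner H w v"
    unfolding complex_cnj_mult using herm[of v w] assms by metis
  finally show "cinner H w (a \<odot>\<^bsub>H\<^esub> v) = cnj a * cinner H w v" .
qed

lemma hnorm_nonneg:
  assumes "hilbert_space H" "v \<in> carrier H"
  shows "0 \<le> hnorm H v"
proof -
  have "0 \<le> Re (cinner H v v)" using assms unfolding hilbert_space_def by blast
  then show ?thesis by (simp add: hnorm_def)
qed

lemma cinner_self:
  assumes "hilbert_space H" "v \<in> carrier H"
  shows "cinner H v v = complex_of_real ((hnorm H v)\<^sup>2)"
proof -
  have "Im (cinner H v v) = Im (cnj (cinner H v v))"
    using cinner_sesquilinear(1)[OF assms(1,2,2,2)] by (rule arg_cong)
  then have "Im (cinner H v v) = 0" by simp
  moreover have "0 \<le> Re (cinner H v v)" using assms unfolding hilbert_space_def by blast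
  ultimately show ?thesis by (simp add: hnorm_def complex_eq_iff)
qed

lemma hnorm_scale:
  assumes "hilbert_space H" "v \<in> carrier H"
  shows "hnorm H (a \<odot>\<^bsub>H\<^esub> v) = cmod a * hnorm H v"
proof -
  have "cinner H (a \<odot>\<^bsub>H\<^esub> v) (a \<odot>\<^bsub>H\<^esub> v) = (a * cnj a) * cinner H v v"
    using cinner_sesquilinear(4,5)[OF assms(1,2,2)] hilbert_space_closed[OF assms(1)] assms by simp
  also have "\<dots> = complex_of_real ((cmod a * hnorm H v)\<^sup>2)"
    using cinner_self[OF assms] complex_norm_square[of a] by (simp add: power_mult_distrib)
  finally have "hnorm H (a \<odot>\<^bsub>H\<^esub> v) = sqrt ((cmod a * hnorm H v)\<^sup>2)"
    unfolding hnorm_def[of H "a \<odot>\<^bsub>H\<^esub> v"] by simp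
  then show ?thesis using hnorm_nonneg[OF assms] by simp
qed

lemma hnorm_zero:
  assumes "hilbert_space H"
  shows "hnorm H \<zero>\<^bsub>H\<^esub> = 0"
proof -
  interpret Module.module complex_ring H using assms unfolding hilbert_space_def by (rule conjunct1)
  have "0 \<odot>\<^bsub>H\<^esub> \<zero>\<^bsub>H\<^esub> = \<zero>\<^bsub>H\<^esub>"
    using smult_l_null[OF M.zero_closed] by (simp add: complex_ring_def)
  then show ?thesis using hnorm_scale[OF assms M.zero_closed, of 0] by simp
qed

lemma bopD:
  assumes "T \<in> bop H" "v \<in> carrier H"
  shows "T v \<in> carrier H"
    and "w \<in> carrier H \<Longrightarrow> T (v \<oplus>\<^bsub>H\<^esub> w) = T v \<oplus>\<^bsub>H\<^esub> T w"
    and "T (a \<odot>\<^bsub>H\<^esub> v) = a \<odot>\<^bsub>H\<^esub> T v"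
  using assms by (auto simp: bop_def PiE_iff)

text \<open>The supremum defining the operator norm is not meaningful unless it is taken over a nonempty
  bounded set; the zero vector and the boundedness of \<open>T\<close> provide this.\<close>

lemma opnorm_le_1_iff:
  assumes H: "hilbert_space H" and T: "T \<in> bop H"
  shows "opnorm H T \<le> 1 \<longleftrightarrow> (\<forall>v\<in>carrier H. hnorm H (T v) \<le> hnorm H v)"
proof -
  let ?A = "{hnorm H (T v) | v. v \<in> carrier H \<and> hnorm H v \<le> 1}"
  obtain c where c: "\<And>v. v \<in> carrier H \<Longrightarrow> hnorm H (T v) \<le> c * hnorm H v"
    using T unfolding bop_def by blast
  have c_abs: "hnorm H (T v) \<le> \<bar>c\<bar>" if "v \<in> carrier H" "hnorm H v \<le> 1" for v
  proof -
    have "c * hnorm H v \<le> \<bar>c\<bar> * hnorm H v"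
      by (rule mult_right_mono) (use hnorm_nonneg[OF H that(1)] in auto)
    also have "\<dots> \<le> \<bar>c\<bar> * 1" by (rule mult_left_mono) (use that in auto)
    finally show ?thesis using c[OF that(1)] by simp
  qed
  then have bdd: "bdd_above ?A" by (auto intro!: bdd_aboveI[of _ "\<bar>c\<bar>"])
  have nonempty: "?A \<noteq> {}" using hilbert_space_closed(1)[OF H] hnorm_zero[OF H] by force
  have unit_ball: "opnorm H T \<le> 1 \<longleftrightarrow> (\<forall>v\<in>carrier H. hnorm H v \<le> 1 \<longrightarrow> hnorm H (T v) \<le> 1)"
    unfolding opnorm_def using cSup_le_iff[OF nonempty bdd] by auto
  have "hnorm H (T v) \<le> hnorm H v"
    if ball: "\<forall>v\<in>carrier H. hnorm H v \<le> 1 \<longrightarrow> hnorm H (T v) \<le> 1" and v: "v \<in> carrier H" for v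
  proof (cases "hnorm H v = 0")
    case True
    then show ?thesis using c[OF v] by simp
  next
    case False
    then have pos: "hnorm H v > 0" using hnorm_nonneg[OF H v] by simp
    let ?a = "complex_of_real (1 / hnorm H v)"
    have "hnorm H (?a \<odot>\<^bsub>H\<^esub> v) = 1"
      using hnorm_scale[OF H v, of ?a] pos by (simp add: norm_divide)
    then have "hnorm H (T (?a \<odot>\<^bsub>H\<^esub> v)) \<le> 1"
      using ball hilbert_space_closed(3)[OF H v] by simp
    then have "hnorm H (T v) / hnorm H v \<le> 1"
      using hnorm_scale[OF H bopD(1)[OF T v], of ?a] bopD(3)[OF T v] pos
      by (simp add: norm_divide)
    then show ?thesis using pos by (simp add: field_simps)
  qed
  then show ?thesis using unit_ball by fastforce
qed

text \<open>Polarisation: equality of the norms at \<open>v + w\<close> and at \<open>v + i w\<close> controls the sum and the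
  difference, respectively, of the two mixed inner products.\<close>

lemma cinner_eq_of_hnorm_eq:
  assumes H: "hilbert_space H" and A: "A \<in> bop H" and B: "B \<in> bop H"
    and norm_eq: "\<And>v. v \<in> carrier H \<Longrightarrow> hnorm H (A v) = hnorm H (B v)"
    and v: "v \<in> carrier H" and w: "w \<in> carrier H"
  shows "cinner H (A v) (A w) = cinner H (B v) (B w)"
proof -
  have self_eq: "cinner H (A u) (A u) = cinner H (B u) (B u)" if "u \<in> carrier H" for u
    using norm_eq[OF that] cinner_self[OF H bopD(1)[OF A that]] cinner_self[OF H bopD(1)[OF B that]]
    by simp
  have expand: "cinner H (T (v \<oplus>\<^bsub>H\<^esub> a \<odot>\<^bsub>H\<^esub> w)) (T (v \<oplus>\<^bsub>H\<^esub> a \<odot>\<^bsub>H\<^esub> w))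
      = cinner H (T v) (T v) + cnj a * cinner H (T v) (T w)
        + a * cinner H (T w) (T v) + a * cnj a * cinner H (T w) (T w)"
    if T: "T \<in> bop H" for T a
    using bopD[OF T] cinner_sesquilinear(2-5)[OF H] hilbert_space_closed[OF H] v w
    by (simp add: algebra_simps)
  have mixed: "cnj a * cinner H (A v) (A w) + a * cinner H (A w) (A v)
      = cnj a * cinner H (B v) (B w) + a * cinner H (B w) (B v)" for a
    using self_eq[of "v \<oplus>\<^bsub>H\<^esub> a \<odot>\<^bsub>H\<^esub> w"] self_eq[OF v] self_eq[OF w] expand[OF A, of a]
      expand[OF B, of a] hilbert_space_closed[OF H] v w by simp
  have "\<i> * (cinner H (A w) (A v) - cinner H (A v) (A w))
      = \<i> * (cinner H (B w) (B v) - cinner H (B v) (B w))"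
    using mixed[of \<i>] by (simp add: algebra_simps)
  then have "cinner H (A w) (A v) - cinner H (A v) (A w)
      = cinner H (B w) (B v) - cinner H (B v) (B w)" by simp
  moreover have "cinner H (A v) (A w) + cinner H (A w) (A v)
      = cinner H (B v) (B w) + cinner H (B w) (B v)"
    using mixed[of 1] by simp
  ultimately show ?thesis by (simp add: complex_eq_iff)
qed

text \<open>Since \<open>\<parallel>T v\<parallel> = \<parallel>U T v\<parallel>\<close>, polarisation moves \<open>T\<close> across the inner product up to the
  projections:
  \<open>\<langle>T v, w\<rangle> = \<langle>T v, T U w\<rangle> = \<langle>U T v, U T U w\<rangle> = \<langle>v, U w\<rangle>\<close>.\<close>

lemma contractive_inverse_is_adjoint:
  assumes H: "hilbert_space H" and T: "T \<in> bop H" and U: "U \<in> bop H"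
    and contr_T: "\<And>v. v \<in> carrier H \<Longrightarrow> hnorm H (T v) \<le> hnorm H v"
    and contr_U: "\<And>v. v \<in> carrier H \<Longrightarrow> hnorm H (U v) \<le> hnorm H v"
    and TUT: "\<And>v. v \<in> carrier H \<Longrightarrow> T (U (T v)) = T v"
    and UTU: "\<And>v. v \<in> carrier H \<Longrightarrow> U (T (U v)) = U v"
    and P: "P = compose (carrier H) T U" "is_adjoint H P P"
    and Q: "Q = compose (carrier H) U T" "Q \<in> bop H" "is_adjoint H Q Q"
  shows "is_adjoint H T U"
  unfolding is_adjoint_def
proof (intro ballI)
  fix v w assume v: "v \<in> carrier H" and w: "w \<in> carrier H"
  note closed = bopD(1)[OF T] bopD(1)[OF U]
  have isometric: "hnorm H (T u) = hnorm H (Q u)" if u: "u \<in> carrier H" for u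
    using contr_U[of "T u"] contr_T[of "U (T u)"] TUT[OF u] closed u
    by (simp add: Q(1) compose_eq)
  have "cinner H (T v) w = cinner H (P (T v)) w"
    using TUT[OF v] closed v by (simp add: P(1) compose_eq)
  also have "\<dots> = cinner H (T v) (T (U w))"
    using P(2) closed v w by (simp add: is_adjoint_def) (simp add: P(1) compose_eq)
  also have "\<dots> = cinner H (Q v) (Q (U w))"
    by (rule cinner_eq_of_hnorm_eq[OF H T Q(2)]) (use isometric closed v w in auto)
  also have "\<dots> = cinner H (Q v) (U w)"
    using UTU[OF w] closed w by (simp add: Q(1) compose_eq)
  also have "\<dots> = cinner H v (Q (U w))"
    using Q(3) closed v w by (simp add: is_adjoint_def)
  also have "\<dots> = cinner H v (U w)"
    using UTU[OF w] closed w by (simp add: Q(1) compose_eq)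
  finally show "cinner H (T v) w = cinner H v (U w)" .
qed

section \<open>Representations of inverse semigroups\<close>

lemma sinv_idempotent:
  fixes e :: "'s::inverse_semigroup"
  assumes "e * e = e"
  shows "sinv e = e"
  using ex1_sinv[of e] sinv_props[of e] assms by metis

lemma mult_sinv_idempotent:
  fixes s :: "'s::inverse_semigroup"
  shows "s * sinv s \<in> idempotents" and "sinv s * s \<in> idempotents"
  using sinv_props[of s] by (metis (mono_tags, lifting) idempotents_def mem_Collect_eq mult.assoc)+

lemma star_representation_contraction:
  fixes s :: "'s::inverse_semigroup"
  assumes H: "hilbert_space H" and \<sigma>: "star_representation H \<sigma>"
    and v: "v \<in> carrier H"
  shows "hnorm H (\<sigma> s v) \<le> hnorm H v"
proof -
  have bop: "\<sigma> t \<in> bop H"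
    and mult: "\<sigma> (t * u) = compose (carrier H) (\<sigma> t) (\<sigma> u)"
    and adj: "is_adjoint H (\<sigma> t) (\<sigma> (sinv t))" for t u
    using \<sigma> by (auto simp: star_representation_def)
  note closed = bopD(1)[OF bop]
  let ?p = "\<sigma> (sinv s * s) v"
  have sq: "cinner H (\<sigma> s v) (\<sigma> s v) = cinner H v ?p"
    using adj[of s] closed v by (simp add: is_adjoint_def mult compose_eq)
  have e: "(sinv s * s) * (sinv s * s) = sinv s * s"
    using mult_sinv_idempotent[of s] by (simp add: idempotents_def)
  have "cinner H ?p ?p = cinner H v (\<sigma> (sinv s * s) ?p)"
    using adj[of "sinv s * s"] sinv_idempotent[OF e] closed v by (simp add: is_adjoint_def)
  also have "\<sigma> (sinv s * s) ?p = ?p"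
    using mult[of "sinv s * s" "sinv s * s"] v by (metis e compose_eq)
  finally have pp: "cinner H ?p ?p = cinner H v ?p" .
  have p: "?p \<in> carrier H" using closed v by blast
  have pv: "cinner H ?p v = cinner H v ?p"
    using pp cinner_sesquilinear(1)[OF H v v p] cinner_sesquilinear(1)[OF H p p p] by metis
  \<comment> \<open>Pythagoras: \<open>\<parallel>v\<parallel>\<^sup>2 = \<parallel>p\<parallel>\<^sup>2 + \<parallel>v - p\<parallel>\<^sup>2\<close> for the projection \<open>p\<close> of \<open>v\<close>.\<close>
  let ?d = "v \<oplus>\<^bsub>H\<^esub> (-1) \<odot>\<^bsub>H\<^esub> ?p"
  have mp: "(-1) \<odot>\<^bsub>H\<^esub> ?p \<in> carrier H" and d: "?d \<in> carrier H"
    using hilbert_space_closed[OF H] v p by auto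
  have "cinner H ?d ?d = cinner H v v - cinner H v ?p"
    using cinner_sesquilinear(2-5)[OF H] v p mp d pp pv by simp
  moreover have "0 \<le> Re (cinner H ?d ?d)" using H d unfolding hilbert_space_def by blast
  ultimately have "Re (cinner H (\<sigma> s v) (\<sigma> s v)) \<le> Re (cinner H v v)" using sq by simp
  then show ?thesis by (simp add: hnorm_def)
qed

theorem representation_iff_star_representation:
  fixes \<sigma> :: "'s::inverse_semigroup \<Rightarrow> 'h \<Rightarrow> 'h"
  assumes H: "hilbert_space H"
  shows "representation idempotents H \<sigma> \<longleftrightarrow> star_representation H \<sigma>"
proof
  assume \<sigma>: "star_representation H \<sigma>"
  then have bop: "\<sigma> t \<in> bop H"
    and mult: "\<sigma> (t * u) = compose (carrier H) (\<sigma> t) (\<sigma> u)"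
    and adj: "is_adjoint H (\<sigma> t) (\<sigma> (sinv t))" for t u
    by (auto simp: star_representation_def)
  have "opnorm H (\<sigma> s) \<le> 1" for s
    using opnorm_le_1_iff[OF H bop] star_representation_contraction[OF H \<sigma>] by blast
  moreover have "is_adjoint H (\<sigma> e) (\<sigma> e) \<and> compose (carrier H) (\<sigma> e) (\<sigma> e) = \<sigma> e"
    if "e \<in> idempotents" for e
    using that adj[of e] sinv_idempotent[of e] mult[of e e] by (simp add: idempotents_def)
  ultimately show "representation idempotents H \<sigma>"
    unfolding representation_def using bop mult by blast
next
  assume \<sigma>: "representation idempotents H \<sigma>"
  then have bop: "\<sigma> t \<in> bop H"
    and mult: "\<sigma> (t * u) = compose (carrier H) (\<sigma> t) (\<sigma> u)"
    and norm: "opnorm H (\<sigma> t) \<le> 1"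
    and proj: "e \<in> idempotents \<Longrightarrow> is_adjoint H (\<sigma> e) (\<sigma> e)" for t u e
    unfolding representation_def by blast+
  have contr: "hnorm H (\<sigma> t v) \<le> hnorm H v" if "v \<in> carrier H" for t v
    using opnorm_le_1_iff[OF H bop] norm that by blast
  have triple: "\<sigma> t (\<sigma> u (\<sigma> r v)) = \<sigma> (t * u * r) v" if "v \<in> carrier H" for t u r v
    using that bopD(1)[OF bop] by (simp add: mult compose_eq)
  have "is_adjoint H (\<sigma> s) (\<sigma> (sinv s))" for s
  proof (rule contractive_inverse_is_adjoint[OF H bop bop])
    show "\<sigma> (s * sinv s) = compose (carrier H) (\<sigma> s) (\<sigma> (sinv s))"
      and "\<sigma> (sinv s * s) = compose (carrier H) (\<sigma> (sinv s)) (\<sigma> s)" by (rule mult)+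
  qed (use contr triple bop proj sinv_props[of s] mult_sinv_idempotent[of s] in auto)
  then show "star_representation H \<sigma>"
    unfolding star_representation_def using bop mult by blast
qed

theorem mainTheorem3:
  fixes universe :: "'h itself"
  shows "(\<forall>x :: 's::inverse_semigroup \<Rightarrow>\<^sub>0 complex.
            op_seminorm universe idempotents x = cstar_seminorm universe x) \<and>
         op_algebra universe (idempotents :: 's set) = cstar_algebra universe \<and>
         (\<forall>x :: 's \<Rightarrow>\<^sub>0 complex. reduced_norm inv_lam inv_rho x = cstar_reduced_norm x) \<and>
         reduced_op_algebra (inv_lam :: 's \<Rightarrow> 's) inv_rho = cstar_reduced"
proof -
  have "op_seminorm universe (idempotents :: 's set) x = cstar_seminorm universe x" for x
    unfolding op_seminorm_def cstar_seminorm_def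
    using representation_iff_star_representation by (metis (no_types, opaque_lifting))
  then have seminorm_eq: "op_seminorm universe (idempotents :: 's set) = cstar_seminorm universe" ..
  have "regular_rep inv_lam inv_rho = (wagner_preston :: 's \<Rightarrow> _)"
    by (simp add: fun_eq_iff regular_rep_def wagner_preston_def inv_lam_def inv_rho_def)
  then show ?thesis
    using seminorm_eq
    by (simp add: op_algebra_def cstar_algebra_def reduced_norm_def cstar_reduced_norm_def
        reduced_op_algebra_def cstar_reduced_def)
qed

end
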